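(* Let $S=\begin{pmatrix}a&b\\c&d\end{pmatrix}$ and $T=\begin{pmatrix}\lambda&1\\0&\lambda\end{pmatrix}$ be elements of $\mathrm{SL}(2,\mathbb H)$ with $|\lambda|=1$ and $|\Im\lambda|\le\frac18$, that generate a non-elementary discrete subgroup of $\mathrm{SL}(2,\mathbb H)$, where $T$ is parabolic fixing $\infty$. Then $$|c|\sqrt{|T(ac^{-1})-ac^{-1}|}\,\sqrt{|T(-c^{-1}d)-(-c^{-1}d)|}\ \ge\ \frac{1+\sqrt{1-8|\Im\lambda|}}{2}.$$
   Context: $\mathbb H$ is the division ring of real quaternions. For $q=q_0+q_1i+q_2j+q_3k\in\mathbb H$ ($q_0,\dots,q_3\in\mathbb R$): $\Re q=q_0$, $\Im q=q_1i+q_2j+q_3k$ (a quaternion), $\overline q=\Re q-\Im q$, $|q|=\sqrt{q_0^2+q_1^2+q_2^2+q_3^2}$. For a $2\times2$ quaternionic matrix $A=\begin{pmatrix}a&b\\c&d\end{pmatrix}$, $\det A=\sqrt{|a|^2|d|^2+|b|^2|c|^2-2\Re(a\overline c d\overline b)}$ (which equals $|ad-aca^{-1}b|$ when $a\ne0$); $\mathrm{SL}(2,\mathbb H)$ is the group of such matrices with $\det=1$. It acts on $\widehat{\mathbb H}=\mathbb H\cup\{\infty\}$ by $A(Z)=(aZ+b)(cZ+d)^{-1}$, so that $T(Z)=(\lambda Z+1)\lambda^{-1}$, and by Poincaré extension on hyperbolic 5-space $\mathbf H^5$ (with boundary $\widehat{\mathbb H}$) by orientation-preserving isometries. An element is parabolic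 if it has no fixed point in $\mathbf H^5$ and exactly one fixed point in $\widehat{\mathbb H}$. A subgroup is elementary if it has a finite orbit in $\mathbf H^5\cup\widehat{\mathbb H}$, and non-elementary otherwise. (Since $T$ fixes $\infty$, non-elementarity of $\langle S,T\rangle$ forces $c\ne0$.) *)

theory Defs
  imports "HOL-Analysis.Analysis" "HOL-Algebra.Generated_Groups"
begin

section \<open>Real quaternions\<close>

datatype quat = Quat (qRe: real) (Im1: real) (Im2: real) (Im3: real)

lemma quat_eq_iff:
  "p = q \<longleftrightarrow> qRe p = qRe q \<and> Im1 p = Im1 q \<and> Im2 p = Im2 q \<and> Im3 p = Im3 q"
  by (cases p; cases q) auto

instantiation quat :: ring_1
begin

definition "0 = Quat 0 0 0 0"
definition "1 = Quat 1 0 0 0"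
definition "p + q = Quat (qRe p + qRe q) (Im1 p + Im1 q) (Im2 p + Im2 q) (Im3 p + Im3 q)"
definition "- q = Quat (- qRe q) (- Im1 q) (- Im2 q) (- Im3 q)" for q :: quat
definition "p - q = Quat (qRe p - qRe q) (Im1 p - Im1 q) (Im2 p - Im2 q) (Im3 p - Im3 q)"
definition "p * q = Quat
   (qRe p * qRe q - Im1 p * Im1 q - Im2 p * Im2 q - Im3 p * Im3 q)
   (qRe p * Im1 q + Im1 p * qRe q + Im2 p * Im3 q - Im3 p * Im2 q)
   (qRe p * Im2 q - Im1 p * Im3 q + Im2 p * qRe q + Im3 p * Im1 q)
   (qRe p * Im3 q + Im1 p * Im2 q - Im2 p * Im1 q + Im3 p * qRe q)"

instance
  by standard
    (simp_all add: quat_eq_iff zero_quat_def one_quat_def plus_quat_def uminus_quat_def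
      minus_quat_def times_quat_def algebra_simps)

end

lemma quat_simps [simp]:
  "qRe 0 = 0" "Im1 0 = 0" "Im2 0 = 0" "Im3 0 = 0"
  "qRe 1 = 1" "Im1 1 = 0" "Im2 1 = 0" "Im3 1 = 0"
  "qRe (p + q) = qRe p + qRe q" "Im1 (p + q) = Im1 p + Im1 q"
  "Im2 (p + q) = Im2 p + Im2 q" "Im3 (p + q) = Im3 p + Im3 q"
  "qRe (- q) = - qRe q" "Im1 (- q) = - Im1 q" "Im2 (- q) = - Im2 q" "Im3 (- q) = - Im3 q"
  "qRe (p - q) = qRe p - qRe q" "Im1 (p - q) = Im1 p - Im1 q"
  "Im2 (p - q) = Im2 p - Im2 q" "Im3 (p - q) = Im3 p - Im3 q"
  "qRe (p * q) = qRe p * qRe q - Im1 p * Im1 q - Im2 p * Im2 q - Im3 p * Im3 q"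
  "Im1 (p * q) = qRe p * Im1 q + Im1 p * qRe q + Im2 p * Im3 q - Im3 p * Im2 q"
  "Im2 (p * q) = qRe p * Im2 q - Im1 p * Im3 q + Im2 p * qRe q + Im3 p * Im1 q"
  "Im3 (p * q) = qRe p * Im3 q + Im1 p * Im2 q - Im2 p * Im1 q + Im3 p * qRe q"
  by (simp_all add: zero_quat_def one_quat_def plus_quat_def uminus_quat_def
      minus_quat_def times_quat_def)

instantiation quat :: real_algebra_1
begin

definition "r *\<^sub>R q = Quat (r * qRe q) (r * Im1 q) (r * Im2 q) (r * Im3 q)"

instance
  by standard (simp_all add: quat_eq_iff scaleR_quat_def algebra_simps)

end

lemma quat_scaleR_simps [simp]:
  "qRe (r *\<^sub>R q) = r * qRe q" "Im1 (r *\<^sub>R q) = r * Im1 q"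
  "Im2 (r *\<^sub>R q) = r * Im2 q" "Im3 (r *\<^sub>R q) = r * Im3 q"
  by (simp_all add: scaleR_quat_def)

definition qcnj :: "quat \<Rightarrow> quat" where
  "qcnj q = Quat (qRe q) (- Im1 q) (- Im2 q) (- Im3 q)"

lemma qcnj_simps [simp]:
  "qRe (qcnj q) = qRe q" "Im1 (qcnj q) = - Im1 q" "Im2 (qcnj q) = - Im2 q" "Im3 (qcnj q) = - Im3 q"
  by (simp_all add: qcnj_def)

definition qIm :: "quat \<Rightarrow> quat" where
  "qIm q = Quat 0 (Im1 q) (Im2 q) (Im3 q)"

lemma quat_sq_sum_eq_0_iff:
  "(qRe q)\<^sup>2 + (Im1 q)\<^sup>2 + (Im2 q)\<^sup>2 + (Im3 q)\<^sup>2 = 0 \<longleftrightarrow> q = 0"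
  by (auto simp: quat_eq_iff add_nonneg_eq_0_iff)

instantiation quat :: real_div_algebra
begin

definition "inverse q = inverse ((qRe q)\<^sup>2 + (Im1 q)\<^sup>2 + (Im2 q)\<^sup>2 + (Im3 q)\<^sup>2) *\<^sub>R qcnj q"
definition "p div q = p * inverse q" for p q :: quat

instance
proof
  fix p q :: quat
  let ?n = "(qRe p)\<^sup>2 + (Im1 p)\<^sup>2 + (Im2 p)\<^sup>2 + (Im3 p)\<^sup>2"
  have l: "qcnj p * p = ?n *\<^sub>R 1" and r: "p * qcnj p = ?n *\<^sub>R 1"
    by (simp_all add: quat_eq_iff power2_eq_square)
  show "p \<noteq> 0 \<Longrightarrow> inverse p * p = 1"
    unfolding inverse_quat_def mult_scaleR_left l using quat_sq_sum_eq_0_iff[of p] by simp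
  show "p \<noteq> 0 \<Longrightarrow> p * inverse p = 1"
    unfolding inverse_quat_def mult_scaleR_right r using quat_sq_sum_eq_0_iff[of p] by simp
  show "p div q = p * inverse q"
    by (rule divide_quat_def)
  show "inverse 0 = (0 :: quat)"
    by (simp add: inverse_quat_def quat_eq_iff)
qed

end

instantiation quat :: real_normed_div_algebra
begin

definition "norm q = sqrt ((qRe q)\<^sup>2 + (Im1 q)\<^sup>2 + (Im2 q)\<^sup>2 + (Im3 q)\<^sup>2)"
definition "sgn q = q /\<^sub>R norm q" for q :: quat
definition "dist p q = norm (p - q)" for p q :: quat
definition
  "(uniformity :: (quat \<times> quat) filter) = (INF e\<in>{0<..}. principal {(x, y). dist x y < e})"
definition
  "open (U :: quat set) \<longleftrightarrow> (\<forall>x\<in>U. eventually (\<lambda>(x', y). x' = x \<longrightarrow> y \<in> U) uniformity)"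

instance
proof
  fix p q :: quat and r :: real and U :: "quat set"
  have pair: "norm x = norm (qRe x, Im1 x, Im2 x, Im3 x)" for x :: quat
    by (simp add: norm_quat_def norm_Pair add.assoc)
  show "norm (p + q) \<le> norm p + norm q"
    using norm_triangle_ineq[of "(qRe p, Im1 p, Im2 p, Im3 p)" "(qRe q, Im1 q, Im2 q, Im3 q)"]
    by (simp add: pair)
  show "norm p = 0 \<longleftrightarrow> p = 0"
    by (simp add: norm_quat_def quat_sq_sum_eq_0_iff)
  show "norm (r *\<^sub>R p) = \<bar>r\<bar> * norm p"
    by (simp add: norm_quat_def power_mult_distrib flip: distrib_left real_sqrt_mult real_sqrt_abs)
  show "norm (p * q) = norm p * norm q"
    unfolding norm_quat_def real_sqrt_mult[symmetric]
    by (rule arg_cong[where f = sqrt]) (simp add: power2_eq_square algebra_simps)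
qed (rule sgn_quat_def dist_quat_def uniformity_quat_def open_quat_def)+

end

section \<open>The group SL(2,H) and its actions\<close>

definition mat2 :: "quat \<Rightarrow> quat \<Rightarrow> quat \<Rightarrow> quat \<Rightarrow> quat^2^2" where
  "mat2 a b c d = vector [vector [a, b], vector [c, d]]"

definition qdet :: "quat^2^2 \<Rightarrow> real" where
  "qdet A = (let a = A$1$1; b = A$1$2; c = A$2$1; d = A$2$2 in
     sqrt ((norm a)\<^sup>2 * (norm d)\<^sup>2 + (norm b)\<^sup>2 * (norm c)\<^sup>2
           - 2 * qRe (a * qcnj c * d * qcnj b)))"

definition SL2H :: "(quat^2^2) monoid" where
  "SL2H = \<lparr>carrier = {A. qdet A = 1}, mult = (**), one = mat 1\<rparr>"

datatype qhat = Fin quat | Infty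

text \<open>
  \<open>mobius_fin\<close> is the bare formula \<open>(a Z + b) (c Z + d)\<^sup>-\<^sup>1\<close>; it is meaningful only
  where \<open>c Z + d \<noteq> 0\<close>, since \<open>inverse 0 = 0\<close>.
\<close>

definition mobius_fin :: "quat^2^2 \<Rightarrow> quat \<Rightarrow> quat" where
  "mobius_fin A z = (A$1$1 * z + A$1$2) * inverse (A$2$1 * z + A$2$2)"

fun mobius :: "quat^2^2 \<Rightarrow> qhat \<Rightarrow> qhat" where
  "mobius A (Fin z) = (if A$2$1 * z + A$2$2 = 0 then Infty else Fin (mobius_fin A z))"
| "mobius A Infty = (if A$2$1 = 0 then Infty else Fin (A$1$1 * inverse (A$2$1)))"

text \<open>
  Hyperbolic 5-space is the upper half-space \<open>{(z, t). t > 0}\<close> over the quaternions, and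
  \<open>poincare_ext A\<close> is the Poincare extension of \<open>mobius A\<close> for \<open>A\<close> of determinant 1,
  \[ (z, t) \mapsto \left(\frac{(az+b)\overline{(cz+d)} + a\overline{c}\,t^2}{|cz+d|^2 + |c|^2t^2},\;
     \frac{t}{|cz+d|^2 + |c|^2t^2}\right). \]
  As \<open>t\<close> tends to 0 this becomes \<open>(az+b)(cz+d)\<^sup>-\<^sup>1\<close>, because \<open>w\<^sup>-\<^sup>1\<close> is the conjugate
  of \<open>w\<close> divided by \<open>|w|\<^sup>2\<close>.
\<close>

definition hyp5 :: "(quat \<times> real) set" where
  "hyp5 = {(z, t). t > 0}"

definition poincare_ext :: "quat^2^2 \<Rightarrow> quat \<times> real \<Rightarrow> quat \<times> real" where
  "poincare_ext A = (\<lambda>(z, t).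
     let a = A$1$1; b = A$1$2; c = A$2$1; d = A$2$2;
         D = (norm (c * z + d))\<^sup>2 + (norm c)\<^sup>2 * t\<^sup>2
     in (((a * z + b) * qcnj (c * z + d) + t\<^sup>2 *\<^sub>R (a * qcnj c)) /\<^sub>R D, t / D))"

definition parabolic :: "quat^2^2 \<Rightarrow> bool" where
  "parabolic A \<longleftrightarrow> (\<forall>x\<in>hyp5. poincare_ext A x \<noteq> x) \<and> (\<exists>!p. mobius A p = p)"

text \<open>
  A point of the union of hyperbolic 5-space and its boundary is either a point of \<open>hyp5\<close> or an
  element of \<open>qhat\<close>, whence the two disjuncts.
\<close>

definition elementary :: "(quat^2^2) set \<Rightarrow> bool" where
  "elementary G \<longleftrightarrow>
     (\<exists>x\<in>hyp5. finite ((\<lambda>A. poincare_ext A x) ` G)) \<or> (\<exists>p. finite ((\<lambda>A. mobius A p) ` G))"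

end

theory Submission
  imports Defs
begin

text \<open>
  Suppose the inequality fails. Iterating \<open>W \<mapsto> W T W\<^sup>-\<^sup>1\<close> from \<open>W = S\<close>, the quantity \<open>X\<close> on the
  left-hand side changes by \<open>X \<mapsto> X' \<le> X\<^sup>2 + 2 |\<Im>\<lambda>|\<close>. Being initially below the larger fixed
  point of this map, it stays below some \<open>M < 1\<close>, and the lower left entries \<open>c\<close> tend to 0
  without vanishing. Some power \<open>U\<close> of \<open>T\<close> has almost no rotational part. For \<open>W\<close> far along the
  iteration, in a coordinate centred at \<open>W\<^sup>-\<^sup>1(\<infinity>)\<close> and scaled by \<open>|c|\<close>, the matrix \<open>U\<close> is close to
  the identity and \<open>W\<close> is bounded. The iteration \<open>W \<mapsto> W U W\<^sup>-\<^sup>1\<close> then converges to \<open>U\<close>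
  through matrices that are not upper triangular, contradicting discreteness.
\<close>

section \<open>Two by two matrices\<close>

lemma mat2_nth [simp]:
  "mat2 a b c d $ 1 $ 1 = a" "mat2 a b c d $ 1 $ 2 = b"
  "mat2 a b c d $ 2 $ 1 = c" "mat2 a b c d $ 2 $ 2 = d"
  by (simp_all add: mat2_def)

lemma mat2_cases: obtains a b c d where "A = mat2 a b c d"
proof
  show "A = mat2 (A$1$1) (A$1$2) (A$2$1) (A$2$2)"
    by (simp add: vec_eq_iff forall_2)
qed

lemma mat2_eq_iff [simp]:
  "mat2 a b c d = mat2 a' b' c' d' \<longleftrightarrow> a = a' \<and> b = b' \<and> c = c' \<and> d = d'"
  by (metis mat2_nth)

lemma mat2_mult [simp]:
  "mat2 a b c d ** mat2 a' b' c' d' =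
    mat2 (a * a' + b * c') (a * b' + b * d') (c * a' + d * c') (c * b' + d * d')"
  by (simp add: vec_eq_iff forall_2 matrix_matrix_mult_def sum_2)

lemma mat_1_eq_mat2: "mat 1 = mat2 1 0 0 1"
  by (simp add: vec_eq_iff forall_2 mat_def)

lemma mat2_diff [simp]:
  "mat2 a b c d - mat2 a' b' c' d' = mat2 (a - a') (b - b') (c - c') (d - d')"
  by (simp add: vec_eq_iff forall_2)

text \<open>The l1 norm of the entries: it is submultiplicative and is read off directly from
  explicit \<open>mat2\<close> matrices.\<close>

definition entry_norm :: "quat^2^2 \<Rightarrow> real" where
  "entry_norm A = norm (A$1$1) + norm (A$1$2) + norm (A$2$1) + norm (A$2$2)"

lemma entry_norm_mat2 [simp]:
  "entry_norm (mat2 a b c d) = norm a + norm b + norm c + norm d"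
  by (simp add: entry_norm_def)

lemma entry_norm_nonneg [simp]: "0 \<le> entry_norm A"
  by (simp add: entry_norm_def)

lemma entry_norm_one [simp]: "entry_norm (mat 1) = 2"
  by (simp add: mat_1_eq_mat2)

lemma entry_norm_triangle: "entry_norm (A + B) \<le> entry_norm A + entry_norm B"
  using norm_triangle_ineq[of "A$1$1" "B$1$1"] norm_triangle_ineq[of "A$1$2" "B$1$2"]
    norm_triangle_ineq[of "A$2$1" "B$2$1"] norm_triangle_ineq[of "A$2$2" "B$2$2"]
  by (simp add: entry_norm_def)

lemma entry_norm_triangle_diff: "entry_norm (A - B) \<le> entry_norm A + entry_norm B"
  using norm_triangle_ineq4[of "A$1$1" "B$1$1"] norm_triangle_ineq4[of "A$1$2" "B$1$2"]
    norm_triangle_ineq4[of "A$2$1" "B$2$1"] norm_triangle_ineq4[of "A$2$2" "B$2$2"]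
  by (simp add: entry_norm_def)

lemma entry_norm_mult: "entry_norm (A ** B) \<le> entry_norm A * entry_norm B"
proof (cases A rule: mat2_cases; cases B rule: mat2_cases)
  fix a b c d a' b' c' d'
  assume A: "A = mat2 a b c d" and B: "B = mat2 a' b' c' d'"
  have *: "norm (x * y + z * w) \<le> norm x * norm y + norm z * norm w" for x y z w :: quat
    by (metis norm_mult norm_triangle_ineq)
  have "entry_norm (A ** B) \<le>
      (norm a * norm a' + norm b * norm c') + (norm a * norm b' + norm b * norm d') +
      (norm c * norm a' + norm d * norm c') + (norm c * norm b' + norm d * norm d')"
    unfolding A B mat2_mult entry_norm_mat2 by (intro add_mono *)
  also have "\<dots> \<le> entry_norm A * entry_norm B"
    unfolding A B entry_norm_mat2 by (simp add: algebra_simps)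
  finally show ?thesis .
qed

text \<open>Links the norm estimates to the topology of \<open>quat^2^2\<close>, in which
  \<open>discrete\<close> is understood.\<close>

lemma tendsto_entry_norm:
  assumes "(\<lambda>n. entry_norm (F n - A)) \<longlonglongrightarrow> 0"
  shows "F \<longlonglongrightarrow> A"
proof (intro vec_tendstoI)
  fix i j
  have "norm (F n $ i $ j - A $ i $ j) \<le> entry_norm (F n - A)" for n
    using exhaust_2[of i] exhaust_2[of j] by (auto simp: entry_norm_def)
  then have "(\<lambda>n. F n $ i $ j - A $ i $ j) \<longlonglongrightarrow> 0"
    by (intro Lim_null_comparison[OF _ assms]) auto
  then show "(\<lambda>n. F n $ i $ j) \<longlonglongrightarrow> A $ i $ j"
    by (rule LIM_zero_cancel)
qed

section \<open>Iterated conjugation near the identity\<close>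

lemma matrix_diff_ldistrib: "A ** (B - C) = A ** B - A ** (C :: 'a::ring_1^'n^'m)"
  by (simp add: vec_eq_iff matrix_matrix_mult_def right_diff_distrib sum_subtractf)

lemma matrix_diff_rdistrib: "(B - C) ** A = B ** A - (C :: 'a::ring_1^'n^'m) ** A"
  by (simp add: vec_eq_iff matrix_matrix_mult_def left_diff_distrib sum_subtractf)

text \<open>The second component carries the inverse of the first along: if V inverts W and U'
  inverts U, then W U' V inverts W U V.\<close>

fun conj_iter :: "'a::ring_1^'n^'n \<Rightarrow> 'a^'n^'n \<Rightarrow> ('a^'n^'n) \<times> ('a^'n^'n) \<Rightarrow> nat
    \<Rightarrow> ('a^'n^'n) \<times> ('a^'n^'n)" where
  "conj_iter U U' P 0 = P"
| "conj_iter U U' P (Suc n) =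
    (let (W, V) = conj_iter U U' P n in (W ** U ** V, W ** U' ** V))"

definition inverse_pair :: "('a::ring_1^'n^'n) \<times> ('a^'n^'n) \<Rightarrow> bool" where
  "inverse_pair P \<longleftrightarrow> fst P ** snd P = mat 1 \<and> snd P ** fst P = mat 1"

lemma inverse_pair_conj:
  assumes "inverse_pair (U, U')" "inverse_pair (W, V)"
  shows "inverse_pair (W ** U ** V, W ** U' ** V)"
proof -
  have U: "U ** U' = mat 1" "U' ** U = mat 1" and W: "W ** V = mat 1" "V ** W = mat 1"
    using assms by (simp_all add: inverse_pair_def)
  have "(W ** X ** V) ** (W ** Y ** V) = W ** (X ** (V ** W) ** Y) ** V" for X Y
    by (simp add: matrix_mul_assoc)
  then show ?thesis
    by (simp add: inverse_pair_def U W)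
qed

lemma inverse_pair_conj_iter:
  assumes "inverse_pair (U, U')" "inverse_pair P"
  shows "inverse_pair (conj_iter U U' P n)"
  using assms by (induction n) (auto simp: split_beta intro!: inverse_pair_conj)

text \<open>Since \<open>W U V - U = ((W - U) (U - 1) - (U - 1) (W - U)) V\<close> when \<open>V\<close> inverts \<open>W\<close>,
  conjugating \<open>U\<close> by \<open>W\<close> brings \<open>W\<close> closer to \<open>U\<close>.\<close>

lemma entry_norm_conj_diff:
  assumes "inverse_pair (W, V)"
  shows "entry_norm (W ** U ** V - U)
    \<le> 2 * entry_norm (U - mat 1) * entry_norm V * entry_norm (W - U)"
proof -
  have V: "W ** V = mat 1" using assms by (simp add: inverse_pair_def)
  let ?E = "W - U" and ?R = "U - mat 1"
  have "U ** W ** V = U" by (simp add: V flip: matrix_mul_assoc)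
  then have "W ** U ** V - U = (W ** U - U ** W) ** V"
    by (simp add: matrix_diff_rdistrib)
  also have "W ** U - U ** W = ?E ** ?R - ?R ** ?E"
    by (simp add: matrix_diff_rdistrib matrix_diff_ldistrib)
  finally have "entry_norm (W ** U ** V - U) \<le> entry_norm (?E ** ?R - ?R ** ?E) * entry_norm V"
    by (simp add: entry_norm_mult)
  also have "entry_norm (?E ** ?R - ?R ** ?E) \<le> entry_norm (?E ** ?R) + entry_norm (?R ** ?E)"
    by (rule entry_norm_triangle_diff)
  also have "\<dots> \<le> entry_norm ?E * entry_norm ?R + entry_norm ?R * entry_norm ?E"
    by (intro add_mono entry_norm_mult)
  finally show ?thesis by (simp add: mult_right_mono algebra_simps)
qed

text \<open>The identity V = 1 - (W - 1) V gives \<open>entry_norm V\<close> \<le> 2 +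
  \<open>entry_norm V\<close> / 2.\<close>

lemma entry_norm_inverse_le:
  assumes "inverse_pair (W, V)" "entry_norm (W - mat 1) \<le> 1 / 2"
  shows "entry_norm V \<le> 4"
proof -
  have "V = mat 1 - (W - mat 1) ** V"
    using assms(1) by (simp add: inverse_pair_def matrix_diff_rdistrib)
  then have "entry_norm V \<le> 2 + entry_norm ((W - mat 1) ** V)"
    by (metis entry_norm_triangle_diff entry_norm_one)
  also have "entry_norm ((W - mat 1) ** V) \<le> entry_norm (W - mat 1) * entry_norm V"
    by (rule entry_norm_mult)
  also have "\<dots> \<le> 1 / 2 * entry_norm V"
    using assms(2) by (intro mult_right_mono) auto
  finally show ?thesis by simp
qed

text \<open>While the inverses stay bounded by 4, each step shrinks the distance to U by the factor
  2 * 4 / 128 = 1/16. From the first step on, the matrix is within 1/2 of the identity, so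
  \<open>entry_norm_inverse_le\<close> renews the bound 4.\<close>

lemma conj_iter_entry_norm_tendsto:
  assumes U: "inverse_pair (U, U')" and W: "inverse_pair (W, V)"
    and small: "entry_norm (U - mat 1) \<le> 1 / 128"
    and bounds: "entry_norm W \<le> 4" "entry_norm V \<le> 4"
  shows "(\<lambda>n. entry_norm (fst (conj_iter U U' (W, V) n) - U)) \<longlonglongrightarrow> 0"
proof -
  define w where "w n = fst (conj_iter U U' (W, V) n)" for n
  define v where "v n = snd (conj_iter U U' (W, V) n)" for n
  have inv: "inverse_pair (w n, v n)" for n
    using inverse_pair_conj_iter[OF U W] by (simp add: w_def v_def)
  have w_Suc: "w (Suc n) = w n ** U ** v n" for n
    by (simp add: w_def v_def split_beta)
  \<comment> \<open>The 7 leaves room for the initial distance, at most (4 + 2) + 1/128.\<close>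
  have 1: "entry_norm (w n - U) \<le> 7 * (1 / 16) ^ n \<and> entry_norm (v n) \<le> 4" for n
  proof (induction n)
    case 0
    have "entry_norm (W - U) = entry_norm ((W - mat 1) - (U - mat 1))" by simp
    also have "\<dots> \<le> entry_norm (W - mat 1) + entry_norm (U - mat 1)"
      by (rule entry_norm_triangle_diff)
    also have "\<dots> \<le> (4 + 2) + 1 / 128"
      using entry_norm_triangle_diff[of W "mat 1"] bounds small by simp
    finally show ?case using bounds by (simp add: w_def v_def)
  next
    case (Suc n)
    have "entry_norm (w (Suc n) - U)
        \<le> 2 * entry_norm (U - mat 1) * entry_norm (v n) * entry_norm (w n - U)"
      unfolding w_Suc by (rule entry_norm_conj_diff[OF inv])
    also have "\<dots> \<le> 2 * (1 / 128) * 4 * (7 * (1 / 16) ^ n)"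
      using Suc small by (intro mult_mono) auto
    finally have e: "entry_norm (w (Suc n) - U) \<le> 7 * (1 / 16) ^ Suc n" by simp
    have "(1 / 16) ^ n \<le> (1 :: real)" by (simp add: power_le_one)
    with e have e': "entry_norm (w (Suc n) - U) \<le> 7 / 16" by simp
    have "entry_norm (w (Suc n) - mat 1) = entry_norm ((w (Suc n) - U) + (U - mat 1))" by simp
    also have "\<dots> \<le> entry_norm (w (Suc n) - U) + entry_norm (U - mat 1)"
      by (rule entry_norm_triangle)
    also have "\<dots> \<le> 1 / 2" using e' small by simp
    finally show ?case using e entry_norm_inverse_le[OF inv] by blast
  qed
  have "(\<lambda>n. 7 * (1 / 16 :: real) ^ n) \<longlonglongrightarrow> 0"
    by (intro tendsto_mult_right_zero LIMSEQ_power_zero) simp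
  then have "(\<lambda>n. entry_norm (w n - U)) \<longlonglongrightarrow> 0"
    by (rule Lim_null_comparison[rotated]) (use 1 in auto)
  then show ?thesis
    by (simp add: w_def)
qed

section \<open>Parabolic matrices\<close>

lemma qRe_mult_commute: "qRe (x * y) = qRe (y * x)"
  by simp

text \<open>The real part of \<open>\<lambda>\<^sup>-\<^sup>m (\<lambda>\<^sup>m\<^sup>+\<^sup>1 z - z \<lambda>\<^sup>m\<^sup>+\<^sup>1)\<close> vanishes, because \<open>\<Re>(xy) = \<Re>(yx)\<close>.\<close>

lemma parabolic_power_no_fixed_point:
  fixes lam z :: quat
  assumes "lam \<noteq> 0"
  shows "lam ^ Suc m * z + of_nat (Suc m) * lam ^ m - z * lam ^ Suc m \<noteq> 0"
proof
  let ?i = "inverse (lam ^ m)"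
  assume *: "lam ^ Suc m * z + of_nat (Suc m) * lam ^ m - z * lam ^ Suc m = 0"
  have i: "?i * lam ^ m = 1" using assms by simp
  have 1: "?i * (lam ^ Suc m * z) = lam * z"
    using i by (simp only: power_Suc2 mult.assoc[symmetric]) simp
  have 2: "?i * (of_nat (Suc m) * lam ^ m) = of_nat (Suc m)"
    using i by (metis mult.assoc mult_1_right mult_of_nat_commute)
  have "qRe (?i * (z * lam ^ Suc m)) = qRe (z * lam ^ Suc m * ?i)"
    by (rule qRe_mult_commute)
  also have "z * lam ^ Suc m * ?i = z * lam"
    using assms by (simp add: mult.assoc)
  also have "qRe (z * lam) = qRe (lam * z)"
    by (rule qRe_mult_commute)
  finally have 3: "qRe (?i * (z * lam ^ Suc m)) = qRe (lam * z)" .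
  have "qRe (?i * (lam ^ Suc m * z + of_nat (Suc m) * lam ^ m - z * lam ^ Suc m)) = qRe (of_nat (Suc m))"
    unfolding distrib_left right_diff_distrib 1 2 using 3 by simp
  moreover have "qRe (of_nat k) = of_nat k" for k by (induction k) auto
  ultimately show False unfolding * by simp
qed

section \<open>Commutators and powers of quaternions\<close>

lemma quat_eq_Re_Im: "q = of_real (qRe q) + qIm q"
  by (simp add: quat_eq_iff qIm_def of_real_def)

text \<open>The real part of \<open>lam\<close> is central, so only \<open>qIm lam\<close>
  contributes.\<close>

lemma norm_commutator_le:
  "norm (lam * h - h * lam) \<le> 2 * norm (qIm lam) * norm h" for lam h :: quat
proof -
  have "lam * h - h * lam = qIm lam * h - h * qIm lam"
    by (simp add: quat_eq_iff qIm_def algebra_simps)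
  also have "norm \<dots> \<le> norm (qIm lam * h) + norm (h * qIm lam)"
    by (rule norm_triangle_ineq4)
  finally show ?thesis by (simp add: norm_mult mult.commute mult.left_commute)
qed

text \<open>If \<open>qIm lam\<close> is nonzero, \<open>lam\<close> generates a copy of the complex
  numbers whose imaginary unit is the normalized \<open>qIm lam\<close>. Multiplying through by
  \<open>norm (qIm lam)\<close> avoids a division by zero for real \<open>lam\<close>.\<close>

lemma power_eq_complex_power:
  fixes lam :: quat
  defines "z \<equiv> Complex (qRe lam) (norm (qIm lam))"
  shows "norm (qIm lam) *\<^sub>R lam ^ n
    = of_real (norm (qIm lam) * Re (z ^ n)) + Im (z ^ n) *\<^sub>R qIm lam"
proof -
  define r where "r = norm (qIm lam)"
  have r2: "r * r = Im1 lam * Im1 lam + Im2 lam * Im2 lam + Im3 lam * Im3 lam"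
    unfolding r_def power2_eq_square[symmetric] by (simp add: norm_quat_def qIm_def)
  have sq: "qIm lam * qIm lam = of_real (- (r * r))"
    unfolding r2 by (simp add: quat_eq_iff qIm_def of_real_def)
  show ?thesis unfolding r_def[symmetric]
  proof (induction n)
    case 0 then show ?case by (simp add: of_real_def)
  next
    case (Suc n)
    have "r *\<^sub>R lam ^ Suc n = (of_real (qRe lam) + qIm lam) * (r *\<^sub>R lam ^ n)"
      by (metis mult_scaleR_right power_Suc quat_eq_Re_Im)
    also have "\<dots> = (of_real (qRe lam) + qIm lam) * (of_real (r * Re (z ^ n)) + Im (z ^ n) *\<^sub>R qIm lam)"
      by (simp only: Suc)
    also have "\<dots> = of_real (r * Re (z ^ Suc n)) + Im (z ^ Suc n) *\<^sub>R qIm lam"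
    proof -
      have "qIm lam * qIm lam = (- (r * r)) *\<^sub>R 1" using sq by (simp add: of_real_def)
      then have "(of_real x + qIm lam) * (of_real (r * u) + y *\<^sub>R qIm lam)
          = of_real (r * (x * u - r * y)) + (x * y + r * u) *\<^sub>R qIm lam" for x u y
        by (simp add: of_real_def algebra_simps)
      then show ?thesis by (simp add: z_def r_def[symmetric])
    qed
    finally show ?case .
  qed
qed

text \<open>By compactness of the circle two powers of z come within \<epsilon> of each other;
  cancelling the smaller power, of modulus 1, leaves a positive power near 1.\<close>

lemma unit_complex_power_near_1:
  fixes z :: complex
  assumes "norm z = 1" "\<epsilon> > 0"
  shows "\<exists>m. norm (z ^ Suc m - 1) < \<epsilon>"
proof -
  have "\<forall>n. z ^ n \<in> sphere 0 1" using assms by (simp add: norm_power)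
  moreover have "compact (sphere 0 1 :: complex set)" by simp
  ultimately obtain l r where r: "strict_mono (r :: nat \<Rightarrow> nat)" and "((\<lambda>n. z ^ n) \<circ> r) \<longlonglongrightarrow> l"
    unfolding compact_def by metis
  then have "Cauchy ((\<lambda>n. z ^ n) \<circ> r)" by (simp add: LIMSEQ_imp_Cauchy)
  then obtain N where "\<forall>m\<ge>N. \<forall>n\<ge>N. dist (z ^ r m) (z ^ r n) < \<epsilon>"
    using assms(2) by (auto simp: Cauchy_def)
  then have d: "dist (z ^ r (Suc N)) (z ^ r N) < \<epsilon>" by simp
  have "r N < r (Suc N)" using r by (simp add: strict_mono_Suc_iff)
  then obtain m where m: "r (Suc N) = r N + Suc m" using less_iff_Suc_add by auto
  have "z ^ r (Suc N) - z ^ r N = z ^ r N * (z ^ Suc m - 1)"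
    unfolding m by (simp add: power_add algebra_simps)
  then have "norm (z ^ Suc m - 1) < \<epsilon>"
    using d assms(1) by (simp add: dist_norm norm_mult norm_power)
  then show ?thesis ..
qed

text \<open>The coefficient \<gamma> is bounded separately because the commutator of
  \<open>lam ^ Suc m\<close> with any quaternion is \<gamma> times that of
  \<open>lam\<close>.\<close>

lemma unit_power_near_1:
  fixes lam :: quat
  assumes "norm lam = 1" "\<epsilon> > 0"
  obtains m \<alpha> \<gamma> where "lam ^ Suc m = of_real \<alpha> + \<gamma> *\<^sub>R qIm lam" "\<bar>\<gamma>\<bar> < \<epsilon>"
    "norm (lam ^ Suc m - 1) < \<epsilon>"
proof (cases "qIm lam = 0")
  \<comment> \<open>A real unit quaternion is 1 or -1, so its square (m = 1) is 1.\<close>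
  case True
  then have lam: "lam = of_real (qRe lam)" using quat_eq_Re_Im[of lam] by simp
  then have "norm (of_real (qRe lam) :: quat) = 1" using assms(1) by simp
  then have "\<bar>qRe lam\<bar> = 1" by (simp del: of_real_eq_1_iff)
  then have "(qRe lam)\<^sup>2 = 1" by (simp add: abs_square_eq_1)
  then have "lam ^ Suc 1 = 1" by (metis lam of_real_1 of_real_power Suc_1)
  then show ?thesis using that[of 1 1 0] assms(2) by simp
next
  case False
  define r where "r = norm (qIm lam)"
  have r: "r > 0" using False by (simp add: r_def)
  define z where "z = Complex (qRe lam) r"
  have r2: "r\<^sup>2 = (Im1 lam)\<^sup>2 + (Im2 lam)\<^sup>2 + (Im3 lam)\<^sup>2"
    by (simp add: r_def norm_quat_def qIm_def)
  have "(norm z)\<^sup>2 = (norm lam)\<^sup>2"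
    by (simp add: z_def cmod_power2 r2 norm_quat_def)
  then have "norm z = 1" using assms(1) by (simp add: power2_eq_1_iff)
      (use norm_ge_zero[of z] in linarith)
  \<comment> \<open>The second term of the minimum is there because \<gamma> will be
    \<open>Im w / r\<close>.\<close>
  define e where "e = min (\<epsilon> / 3) (\<epsilon> * r / 3)"
  have e: "e > 0" "e \<le> \<epsilon> / 3" "e \<le> \<epsilon> * r / 3" using assms(2) r by (auto simp: e_def)
  from unit_complex_power_near_1[OF \<open>norm z = 1\<close> \<open>e > 0\<close>]
  obtain m where m: "norm (z ^ Suc m - 1) < e" ..
  define w where "w = z ^ Suc m"
  have "r *\<^sub>R lam ^ Suc m = of_real (r * Re w) + Im w *\<^sub>R qIm lam"
    unfolding w_def z_def r_def by (rule power_eq_complex_power)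
  then have "inverse r *\<^sub>R (r *\<^sub>R lam ^ Suc m) = inverse r *\<^sub>R (of_real (r * Re w) + Im w *\<^sub>R qIm lam)"
    by simp
  then have eq: "lam ^ Suc m = of_real (Re w) + (Im w / r) *\<^sub>R qIm lam"
    using r by (simp add: scaleR_add_right scaleR_scaleR divide_inverse_commute scaleR_conv_of_real[symmetric]
        of_real_mult del: power_Suc)
  have Im: "\<bar>Im w\<bar> < e" using abs_Im_le_cmod[of "w - 1"] m by (simp add: w_def)
  have Re: "\<bar>Re w - 1\<bar> < e" using abs_Re_le_cmod[of "w - 1"] m by (simp add: w_def)
  have 1: "\<bar>Im w / r\<bar> < \<epsilon>"
    using r Im e(3) assms(2) by (simp add: abs_divide divide_less_eq)
  have "lam ^ Suc m - 1 = of_real (Re w - 1) + (Im w / r) *\<^sub>R qIm lam"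
    unfolding eq by simp
  also have "norm \<dots> \<le> norm (of_real (Re w - 1) :: quat) + norm ((Im w / r) *\<^sub>R qIm lam)"
    by (rule norm_triangle_ineq)
  also have "\<dots> = \<bar>Re w - 1\<bar> + \<bar>Im w\<bar>"
    using r by (simp add: r_def[symmetric] abs_divide del: of_real_diff)
  also have "\<dots> < \<epsilon>" using Re Im e by linarith
  finally show ?thesis using that eq 1 by blast
qed

section \<open>Bruhat decomposition\<close>

text \<open>The matrix of \<open>z \<mapsto> p + x (z - q)\<^sup>-\<^sup>1 c\<^sup>-\<^sup>1\<close>, which sends \<open>\<infinity>\<close> to \<open>p\<close> and \<open>q\<close> to \<open>\<infinity>\<close>.\<close>

definition bruhat :: "quat \<Rightarrow> quat \<Rightarrow> quat \<Rightarrow> quat \<Rightarrow> quat^2^2" where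
  "bruhat p x c q = mat2 (p * c) (x - p * c * q) c (- (c * q))"

lemma mult_inverse_cancel:
  fixes c y :: "'a::division_ring"
  assumes "c \<noteq> 0"
  shows "c * (inverse c * y) = y" "inverse c * (c * y) = y"
  using assms by (simp_all flip: mult.assoc)

lemma mat2_eq_bruhat:
  assumes "c \<noteq> 0"
  shows "mat2 a b c d = bruhat (a * inverse c) (b - a * inverse c * d) c (- (inverse c * d))"
  using assms by (simp add: bruhat_def mult.assoc mult_inverse_cancel)

lemma inverse_pair_bruhat:
  assumes "c \<noteq> 0" "x \<noteq> 0"
  shows "inverse_pair (bruhat p x c q, bruhat q (inverse c) (inverse x) p)"
  using assms by (simp add: inverse_pair_def bruhat_def mat_1_eq_mat2 algebra_simps mult_inverse_cancel)

text \<open>Let W = \<open>bruhat p x c q\<close> and T(z) = (lam z + \<nu>) lam^-1, so that T(q) -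
  q = t lam^-1. The conjugate sends infinity to W(T(q)) and W(T^-1(q)) to infinity; these are the
  new first and last arguments.\<close>

lemma bruhat_conj:
  fixes lam :: quat
  assumes nz: "c \<noteq> 0" "x \<noteq> 0" "t \<noteq> 0" and t: "t = lam * q + \<nu> - q * lam"
  shows "bruhat p x c q ** mat2 lam \<nu> 0 lam ** bruhat q (inverse c) (inverse x) p
    = bruhat (p + x * lam * inverse t * inverse c) (- (x * lam * inverse t * lam * inverse c))
        (c * t * inverse x) (p - x * inverse t * lam * inverse c)"
proof -
  have \<nu>: "\<nu> = t - lam * q + q * lam" using t by simp
  show ?thesis unfolding \<nu> using nz
    by (simp add: bruhat_def algebra_simps mult_inverse_cancel)
qed

section \<open>The group SL(2,H)\<close>

lemma norm_quat_squared: "(norm q)\<^sup>2 = (qRe q)\<^sup>2 + (Im1 q)\<^sup>2 + (Im2 q)\<^sup>2 + (Im3 q)\<^sup>2"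
  by (simp add: norm_quat_def)

lemma norm_diff_quat_squared:
  "(norm (u - v))\<^sup>2 = (norm u)\<^sup>2 + (norm v)\<^sup>2 - 2 * qRe (v * qcnj u)" for u v :: quat
  unfolding norm_quat_squared by (simp add: power2_eq_square algebra_simps)

lemma qcnj_eq_inverse: "qcnj c = (norm c)\<^sup>2 *\<^sub>R inverse c"
proof (cases "c = 0")
  case True
  then show ?thesis by (simp add: quat_eq_iff)
next
  case False
  show ?thesis using False by (simp add: inverse_quat_def flip: norm_quat_squared)
qed

text \<open>Expand |b - a c^-1 d|^2 by \<open>norm_diff_quat_squared\<close>; the factor |c|^2 turns
  c^-1 into the conjugate of c, which produces the cross term of \<open>qdet\<close>.\<close>

lemma qdet_mat2:
  assumes "c \<noteq> 0"
  shows "qdet (mat2 a b c d) = norm c * norm (b - a * inverse c * d)"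
proof -
  have n: "norm (a * inverse c * d) = norm a * inverse (norm c) * norm d"
    by (simp only: norm_mult norm_inverse)
  have "(norm c * norm (b - a * inverse c * d))\<^sup>2
      = (norm c)\<^sup>2 * ((norm b)\<^sup>2 + (norm (a * inverse c * d))\<^sup>2 - 2 * qRe (a * inverse c * d * qcnj b))"
    by (simp only: power_mult_distrib norm_diff_quat_squared)
  also have "(norm c)\<^sup>2 * (norm (a * inverse c * d))\<^sup>2 = (norm a)\<^sup>2 * (norm d)\<^sup>2"
    unfolding n using assms by (simp add: power_mult_distrib field_simps)
  then have "(norm c)\<^sup>2 * ((norm b)\<^sup>2 + (norm (a * inverse c * d))\<^sup>2 - 2 * qRe (a * inverse c * d * qcnj b))
      = (norm a)\<^sup>2 * (norm d)\<^sup>2 + (norm b)\<^sup>2 * (norm c)\<^sup>2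
        - 2 * ((norm c)\<^sup>2 * qRe (a * inverse c * d * qcnj b))"
    by (simp only: distrib_left right_diff_distrib) (simp only: mult_ac add_ac)
  also have "(norm c)\<^sup>2 * qRe (a * inverse c * d * qcnj b) = qRe ((norm c)\<^sup>2 *\<^sub>R (a * inverse c * d * qcnj b))"
    by (rule quat_scaleR_simps(1)[symmetric])
  also have "(norm c)\<^sup>2 *\<^sub>R (a * inverse c * d * qcnj b) = a * qcnj c * d * qcnj b"
    by (simp only: qcnj_eq_inverse[of c] mult_scaleR_left mult_scaleR_right)
  finally have "qdet (mat2 a b c d) = sqrt ((norm c * norm (b - a * inverse c * d))\<^sup>2)"
    by (simp only: qdet_def Let_def mat2_nth)
  then show ?thesis by simp
qed

lemma qdet_mat2_upper: "qdet (mat2 a b 0 d) = norm a * norm d"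
proof -
  have "qcnj 0 = 0" by (simp add: quat_eq_iff)
  then show ?thesis by (simp only: qdet_def Let_def mat2_nth) (simp add: real_sqrt_mult)
qed

lemma qdet_bruhat:
  assumes "c \<noteq> 0"
  shows "qdet (bruhat p x c q) = norm c * norm x"
  using assms by (simp add: bruhat_def qdet_mat2 algebra_simps mult_inverse_cancel)

lemma inverse_pair_unique:
  assumes "inverse_pair (A, V)" "inverse_pair (A, V')"
  shows "V = V'"
proof -
  have "V = V ** (A ** V')" using assms(2) by (simp add: inverse_pair_def)
  also have "\<dots> = (V ** A) ** V'" by (rule matrix_mul_assoc)
  also have "\<dots> = V'" using assms(1) by (simp add: inverse_pair_def)
  finally show ?thesis .
qed

text \<open>The inverse is written out for c = 0 and, in Bruhat form, for c nonzero. The last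
  conclusion keeps generated subgroups upper triangular.\<close>

lemma SL2H_inverse:
  assumes "A \<in> carrier SL2H"
  obtains V where "V \<in> carrier SL2H" "inverse_pair (A, V)" "A$2$1 = 0 \<Longrightarrow> V$2$1 = 0"
proof (cases A rule: mat2_cases)
  case (1 a b c d)
  have det: "qdet (mat2 a b c d) = 1" using assms by (simp add: SL2H_def 1)
  show ?thesis
  proof (cases "c = 0")
    case True
    then have ad: "norm a * norm d = 1" using det by (simp add: qdet_mat2_upper)
    then have nz: "a \<noteq> 0" "d \<noteq> 0" by auto
    let ?V = "mat2 (inverse a) (- (inverse a * b * inverse d)) 0 (inverse d)"
    have "norm (inverse a) * norm (inverse d) = 1"
      by (simp only: norm_inverse inverse_mult_distrib[symmetric] ad inverse_1)
    then have "?V \<in> carrier SL2H" by (simp add: SL2H_def qdet_mat2_upper)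
    moreover have "inverse_pair (A, ?V)"
      using nz by (simp add: 1 True inverse_pair_def mat_1_eq_mat2 mult.assoc mult_inverse_cancel)
    ultimately show ?thesis using that by simp
  next
    case False
    define p x q where "p = a * inverse c" and "x = b - a * inverse c * d" and "q = - (inverse c * d)"
    have A: "A = bruhat p x c q" using mat2_eq_bruhat[OF False] by (simp add: 1 p_def x_def q_def)
    have cx: "norm c * norm x = 1" using det False by (simp add: qdet_mat2 x_def)
    then have "x \<noteq> 0" by auto
    let ?V = "bruhat q (inverse c) (inverse x) p"
    have "qdet ?V = norm (inverse x) * norm (inverse c)"
      using \<open>x \<noteq> 0\<close> by (intro qdet_bruhat) simp
    also have "\<dots> = inverse (norm c * norm x)"
      by (simp only: norm_inverse inverse_mult_distrib mult.commute)
    also have "\<dots> = 1" by (simp add: cx)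
    finally have "?V \<in> carrier SL2H" by (simp add: SL2H_def)
    moreover have "inverse_pair (A, ?V)"
      unfolding A using False \<open>x \<noteq> 0\<close> by (rule inverse_pair_bruhat)
    ultimately show ?thesis using that False by (simp add: 1)
  qed
qed

text \<open>\<open>m_inv\<close> is a definite description, so uniqueness of two-sided matrix
  inverses settles its value.\<close>

lemma inv_SL2H_eq:
  assumes "V \<in> carrier SL2H" "inverse_pair (A, V)"
  shows "inv\<^bsub>SL2H\<^esub> A = V"
  unfolding m_inv_def
proof (rule the_equality)
  show "V \<in> carrier SL2H \<and> A \<otimes>\<^bsub>SL2H\<^esub> V = \<one>\<^bsub>SL2H\<^esub> \<and> V \<otimes>\<^bsub>SL2H\<^esub> A = \<one>\<^bsub>SL2H\<^esub>"
    using assms by (simp add: SL2H_def inverse_pair_def)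
next
  fix V' assume "V' \<in> carrier SL2H \<and> A \<otimes>\<^bsub>SL2H\<^esub> V' = \<one>\<^bsub>SL2H\<^esub> \<and> V' \<otimes>\<^bsub>SL2H\<^esub> A = \<one>\<^bsub>SL2H\<^esub>"
  then have "inverse_pair (A, V')" by (simp add: SL2H_def inverse_pair_def)
  then show "V' = V" using inverse_pair_unique assms(2) by blast
qed

text \<open>Upper triangular matrices fix infinity, so the orbit of \<open>Infty\<close> is a single
  point.\<close>

lemma elementary_generate_upper_triangular:
  assumes "\<And>A. A \<in> H \<Longrightarrow> A \<in> carrier SL2H \<and> A$2$1 = 0"
  shows "elementary (generate SL2H H)"
proof -
  have "A$2$1 = 0" if "A \<in> generate SL2H H" for A
    using that
  proof induction
    case one
    then show ?case by (simp add: SL2H_def mat_1_eq_mat2)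
  next
    case (incl h)
    then show ?case using assms by blast
  next
    case (inv h)
    then obtain V where "V \<in> carrier SL2H" "inverse_pair (h, V)" "V$2$1 = 0"
      using assms[OF inv] SL2H_inverse by metis
    then show ?case using inv_SL2H_eq by simp
  next
    case (eng A B)
    then show ?case by (simp add: SL2H_def matrix_matrix_mult_def sum_2)
  qed
  then have "(\<lambda>A. mobius A Infty) ` generate SL2H H \<subseteq> {Infty}" by auto
  then show ?thesis unfolding elementary_def by (meson finite.intros finite_subset)
qed

section \<open>Discreteness\<close>

text \<open>The conjugate fixes infinity only if \<open>mat2 \<mu> \<nu> 0 \<mu>\<close> fixes
  W^-1(\<infinity>) = v1 v3^-1. This point is finite because \<open>W$2$1\<close> is nonzero, and
  finite fixed points are excluded by hypothesis.\<close>

lemma conj_lower_left_nonzero: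
  fixes \<mu> \<nu> :: quat
  assumes inv: "inverse_pair (W, V)" and W: "W$2$1 \<noteq> 0"
    and U: "\<And>z. \<mu> * z + \<nu> - z * \<mu> \<noteq> 0"
  shows "(W ** mat2 \<mu> \<nu> 0 \<mu> ** V) $ 2 $ 1 \<noteq> 0"
proof (cases W rule: mat2_cases; cases V rule: mat2_cases)
  fix a b c d v1 v2 v3 v4
  assume W_eq: "W = mat2 a b c d" and V_eq: "V = mat2 v1 v2 v3 v4"
  have WV: "a * v1 + b * v3 = 1" "c * v1 + d * v3 = 0"
    and VW: "v1 * a + v2 * c = 1" "v3 * a + v4 * c = 0"
    "v1 * b + v2 * d = 0" "v3 * b + v4 * d = 1"
    using inv by (simp_all add: inverse_pair_def W_eq V_eq mat_1_eq_mat2)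
  have c: "c \<noteq> 0" using W by (simp add: W_eq)
  have v3: "v3 \<noteq> 0" using WV c by auto
  \<comment> \<open>The vector (y1, y2) is \<open>mat2 \<mu> \<nu> 0 \<mu>\<close> applied to the
    first column of V. If W maps it to (s, 0), it equals the first column of V times s.\<close>
  let ?y1 = "\<mu> * v1 + \<nu> * v3" and ?y2 = "\<mu> * v3"
  show ?thesis
  proof
    assume "(W ** mat2 \<mu> \<nu> 0 \<mu> ** V) $ 2 $ 1 = 0"
    then have 0: "c * ?y1 + d * ?y2 = 0" by (simp add: W_eq V_eq algebra_simps)
    define s where "s = a * ?y1 + b * ?y2"
    have "?y1 = (v1 * a + v2 * c) * ?y1 + (v1 * b + v2 * d) * ?y2" by (simp only: VW) simp
    also have "\<dots> = v1 * s + v2 * (c * ?y1 + d * ?y2)" by (simp add: s_def algebra_simps)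
    finally have y1: "?y1 = v1 * s" by (simp only: 0) simp
    have "?y2 = (v3 * a + v4 * c) * ?y1 + (v3 * b + v4 * d) * ?y2" by (simp only: VW) simp
    also have "\<dots> = v3 * s + v4 * (c * ?y1 + d * ?y2)" by (simp add: s_def algebra_simps)
    finally have y2: "?y2 = v3 * s" by (simp only: 0) simp
    then have s: "s = inverse v3 * \<mu> * v3" using v3 by (simp add: mult.assoc mult_inverse_cancel)
    define z where "z = v1 * inverse v3"
    have "(\<mu> * z + \<nu>) * v3 = ?y1" using v3 by (simp add: z_def algebra_simps)
    also have "\<dots> = z * \<mu> * v3" unfolding y1 s z_def by (simp only: mult.assoc)
    finally have "\<mu> * z + \<nu> = z * \<mu>" using v3 by simp
    then show False using U[of z] by simp
  qed
qed

text \<open>Allows estimates in rescaled coordinates while membership in the group is tracked in the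
  original ones.\<close>

lemma conj_iter_conj:
  assumes D: "D ** D' = mat 1"
  shows "conj_iter (D' ** U ** D) (D' ** U' ** D) (D' ** W ** D, D' ** V ** D) n
    = (D' ** fst (conj_iter U U' (W, V) n) ** D, D' ** snd (conj_iter U U' (W, V) n) ** D)"
proof (induction n)
  case (Suc n)
  have "(D' ** X ** D) ** (D' ** Y ** D) ** (D' ** Z ** D)
      = D' ** (X ** (D ** D') ** Y ** (D ** D') ** Z) ** D" for X Y Z
    by (simp add: matrix_mul_assoc)
  then show ?case using Suc by (simp add: D split_beta)
qed simp

lemma inverse_pair_conj_both:
  assumes D: "inverse_pair (D, D')" and A: "inverse_pair (A, B)"
  shows "inverse_pair (D' ** A ** D, D' ** B ** D)"
  using inverse_pair_conj[OF A, of D' D] D by (simp add: inverse_pair_def)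

lemma discrete_tendsto_eventually_eq:
  assumes "discrete S" "x \<in> S" "\<And>n. f n \<in> S" "f \<longlonglongrightarrow> x"
  shows "eventually (\<lambda>n. f n = x) sequentially"
proof -
  obtain T where T: "open T" "T \<inter> S = {x}"
    using assms(1,2) by (auto simp: discrete_def isolated_in_def)
  then have "eventually (\<lambda>n. f n \<in> T) sequentially"
    using assms(4) by (auto simp: tendsto_def)
  then show ?thesis by eventually_elim (use T assms(3) in blast)
qed

text \<open>In the coordinate \<open>w\<close> with \<open>z = w / |c| + q\<close>, the matrix \<open>U\<close> is close to the identity and
  \<open>bruhat p x c q\<close> is bounded, so the conjugates of \<open>U\<close> converge to \<open>U\<close>
  without ever becoming upper triangular.\<close>

lemma not_discrete_if_small:
  fixes p x c q \<mu> \<nu> :: quat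
  assumes closed: "\<And>A B. A \<in> G \<Longrightarrow> B \<in> G \<Longrightarrow> A ** B \<in> G"
    and U: "inverse_pair (mat2 \<mu> \<nu> 0 \<mu>, U')" "mat2 \<mu> \<nu> 0 \<mu> \<in> G" "U' \<in> G"
    and W: "bruhat p x c q \<in> G" "inverse_pair (bruhat p x c q, V)" "V \<in> G"
    and c: "c \<noteq> 0" and cx: "norm c * norm x = 1" and pq: "norm c * norm (p - q) \<le> 2"
    and small: "2 * norm (\<mu> - 1) + norm c * norm (\<mu> * q + \<nu> - q * \<mu>) \<le> 1 / 128"
    and no_fix: "\<And>z. \<mu> * z + \<nu> - z * \<mu> \<noteq> 0"
  shows "\<not> discrete G"
proof
  assume discr: "discrete G"
  define U where "U = mat2 \<mu> \<nu> 0 \<mu>"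
  define W where "W = bruhat p x c q"
  note U = U[folded U_def] and W = W[folded W_def]
  define r where "r = norm c"
  have r: "r > 0" using c by (simp add: r_def)
  have x: "x \<noteq> 0" using cx by auto
  have V: "V = bruhat q (inverse c) (inverse x) p"
    using inverse_pair_unique[OF W(2)] inverse_pair_bruhat[OF c x] by (simp add: W_def)
  define D where "D = mat2 (inverse r *\<^sub>R 1) q 0 1"
  define D' where "D' = mat2 (r *\<^sub>R 1) (- (r *\<^sub>R q)) 0 1"
  have D: "inverse_pair (D, D')"
    using r by (simp add: D_def D'_def inverse_pair_def mat_1_eq_mat2)
  have DU: "D' ** U ** D = mat2 \<mu> (r *\<^sub>R (\<mu> * q + \<nu> - q * \<mu>)) 0 \<mu>"
    using r by (simp add: D_def D'_def U_def algebra_simps)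
  have DW: "D' ** W ** D = mat2 ((p - q) * c) (r *\<^sub>R x) (inverse r *\<^sub>R c) 0"
    using r by (simp add: D_def D'_def W_def bruhat_def algebra_simps)
  have DV: "D' ** V ** D = mat2 0 (r *\<^sub>R inverse c) (inverse r *\<^sub>R inverse x)
      (- (inverse x * (p - q)))"
    using r by (simp add: D_def D'_def V bruhat_def algebra_simps)
  have nx: "norm x = inverse r" using cx r by (simp add: r_def field_simps)
  have nc: "norm c = r" by (simp add: r_def)
  \<comment> \<open>The entries have norms |c| |p - q| \<le> 2, 1, 1 and 0; the same values occur
    for V.\<close>
  have nW: "entry_norm (D' ** W ** D) \<le> 4"
    using pq r unfolding DW by (simp add: norm_mult norm_inverse nx nc mult.commute)
  have nV: "entry_norm (D' ** V ** D) \<le> 4"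
    using pq r unfolding DV by (simp add: norm_mult norm_inverse nx nc mult.commute)
  have nU: "entry_norm (D' ** U ** D - mat 1) \<le> 1 / 128"
    using small r unfolding DU by (simp add: mat_1_eq_mat2 norm_mult nc)
  define w where "w n = fst (conj_iter U U' (W, V) n)" for n
  define v where "v n = snd (conj_iter U U' (W, V) n)" for n
  have wv_G: "w n \<in> G \<and> v n \<in> G" for n
    using U W closed by (induction n) (auto simp: w_def v_def split_beta)
  have inv: "inverse_pair (w n, v n)" for n
    using inverse_pair_conj_iter[OF U(1) W(2)] by (simp add: w_def v_def)
  have w_Suc: "w (Suc n) = w n ** U ** v n" for n
    by (simp add: w_def v_def split_beta)
  have w_nz: "w n $ 2 $ 1 \<noteq> 0" for n
  proof (induction n)
    case 0
    then show ?case using c by (simp add: w_def W_def bruhat_def)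
  next
    case (Suc n)
    then show ?case
      unfolding w_Suc U_def using inv no_fix by (intro conj_lower_left_nonzero)
  qed
  have "(\<lambda>n. entry_norm (fst (conj_iter (D' ** U ** D) (D' ** U' ** D) (D' ** W ** D, D' ** V ** D) n)
      - D' ** U ** D)) \<longlonglongrightarrow> 0"
    using inverse_pair_conj_both[OF D U(1)] inverse_pair_conj_both[OF D W(2)] nU nW nV
    by (rule conj_iter_entry_norm_tendsto)
  moreover have DD': "D ** D' = mat 1" using D by (simp add: inverse_pair_def)
  ultimately have "(\<lambda>n. entry_norm (D' ** w n ** D - D' ** U ** D)) \<longlonglongrightarrow> 0"
    by (simp add: conj_iter_conj w_def)
  \<comment> \<open>Returning to the original coordinates costs only the constant factor
    \<open>entry_norm D * entry_norm D'\<close>.\<close>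
  then have lim: "(\<lambda>n. entry_norm D * entry_norm (D' ** w n ** D - D' ** U ** D) * entry_norm D') \<longlonglongrightarrow> 0"
    by (intro tendsto_mult_left_zero tendsto_mult_right_zero)
  have "entry_norm (w n - U) \<le> entry_norm D * entry_norm (D' ** w n ** D - D' ** U ** D) * entry_norm D'" for n
  proof -
    have "D ** (D' ** X ** D) ** D' = (D ** D') ** X ** (D ** D')" for X
      by (simp only: matrix_mul_assoc)
    then have "D ** (D' ** X ** D) ** D' = X" for X by (simp add: DD')
    then have "w n - U = D ** (D' ** w n ** D - D' ** U ** D) ** D'"
      by (simp only: matrix_diff_ldistrib matrix_diff_rdistrib)
    then have "entry_norm (w n - U) \<le> entry_norm (D ** (D' ** w n ** D - D' ** U ** D)) * entry_norm D'"
      by (metis entry_norm_mult)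
    also have "\<dots> \<le> (entry_norm D * entry_norm (D' ** w n ** D - D' ** U ** D)) * entry_norm D'"
      by (intro mult_right_mono entry_norm_mult) simp
    finally show ?thesis .
  qed
  then have "(\<lambda>n. entry_norm (w n - U)) \<longlonglongrightarrow> 0"
    by (intro Lim_null_comparison[OF _ lim]) auto
  then have "w \<longlonglongrightarrow> U" by (rule tendsto_entry_norm)
  then have "eventually (\<lambda>n. w n = U) sequentially"
    using discr U(2) wv_G by (intro discrete_tendsto_eventually_eq) auto
  then obtain n where "w n = U" using eventually_happens trivial_limit_sequentially by blast
  then show False using w_nz[of n] by (simp add: U_def)
qed

section \<open>The descent\<close>

text \<open>For \<open>norm lam = 1\<close> this is |T(z) - z|; leaving out the factor
  \<open>inverse lam\<close> makes it the norm of a commutator plus 1.\<close>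

definition displ :: "quat \<Rightarrow> quat \<Rightarrow> real" where
  "displ lam z = norm (lam * z + 1 - z * lam)"

lemma displ_nonneg: "0 \<le> displ lam z"
  by (simp add: displ_def)

lemma displ_eq:
  assumes "norm lam = 1"
  shows "norm (mobius_fin (mat2 lam 1 0 lam) z - z) = displ lam z"
proof -
  have "lam \<noteq> 0" using assms by auto
  then have "mobius_fin (mat2 lam 1 0 lam) z - z = (lam * z + 1 - z * lam) * inverse lam"
    by (simp add: mobius_fin_def left_diff_distrib mult.assoc del: divide_inverse)
  then show ?thesis using assms by (simp only: norm_mult norm_inverse displ_def) simp
qed

lemma displ_pos: "lam \<noteq> 0 \<Longrightarrow> 0 < displ lam z"
  using parabolic_power_no_fixed_point[of lam 0 z] by (simp add: displ_def)

text \<open>The expressions at y and z differ by the commutator of \<open>lam\<close> with y -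
  z.\<close>

lemma displ_le: "displ lam y \<le> displ lam z + 2 * norm (qIm lam) * norm (y - z)"
proof -
  have "lam * y + 1 - y * lam = (lam * z + 1 - z * lam) + (lam * (y - z) - (y - z) * lam)"
    by (simp add: algebra_simps)
  then have "displ lam y \<le> displ lam z + norm (lam * (y - z) - (y - z) * lam)"
    unfolding displ_def by (metis norm_triangle_ineq)
  then show ?thesis using norm_commutator_le[of lam "y - z"] by linarith
qed

text \<open>The recursion X' \<le> X^2 + 2 |Im lam|. Both p' and q' lie at distance 1/|c'| from p,
  and |c'| = |c|^2 displ(q). By \<open>displ_le\<close>, |c'| times the displacement at either point
  is at most |c'| displ(p) + 2 |Im lam| = X^2 + 2 |Im lam| \<le> M.\<close>

lemma bruhat_step:
  fixes lam :: quat
  assumes lam: "norm lam = 1" and c: "c \<noteq> 0" and cx: "norm c * norm x = 1"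
    and M: "M\<^sup>2 + 2 * norm (qIm lam) \<le> M"
    and X: "(norm c)\<^sup>2 * (displ lam p * displ lam q) \<le> M\<^sup>2"
  obtains p' x' c' q' where
    "bruhat p x c q ** mat2 lam 1 0 lam ** bruhat q (inverse c) (inverse x) p = bruhat p' x' c' q'"
    "c' \<noteq> 0" "norm c' * norm x' = 1" "norm c' = (norm c)\<^sup>2 * displ lam q"
    "norm c' * displ lam p' \<le> M" "norm c' * displ lam q' \<le> M" "norm c' * norm (p' - q') \<le> 2"
proof -
  have nz: "lam \<noteq> 0" "x \<noteq> 0" using lam cx by auto
  define t where "t = lam * q + 1 - q * lam"
  have nt: "norm t = displ lam q" by (simp add: t_def displ_def)
  then have t: "t \<noteq> 0" using displ_pos[OF nz(1), of q] by auto
  define p' where "p' = p + x * lam * inverse t * inverse c"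
  define x' where "x' = - (x * lam * inverse t * lam * inverse c)"
  define c' where "c' = c * t * inverse x"
  define q' where "q' = p - x * inverse t * lam * inverse c"
  have conj: "bruhat p x c q ** mat2 lam 1 0 lam ** bruhat q (inverse c) (inverse x) p = bruhat p' x' c' q'"
    unfolding p'_def x'_def c'_def q'_def using c nz t by (intro bruhat_conj) (simp_all add: t_def)
  have nc: "norm c > 0" "norm x > 0" "norm t > 0" using c nz t by auto
  have nx: "norm x = inverse (norm c)" using cx nc by (simp add: field_simps)
  have nc': "norm c' = (norm c)\<^sup>2 * norm t"
    unfolding c'_def by (simp only: norm_mult norm_inverse nx) (simp add: power2_eq_square)
  have c'_pos: "norm c' > 0" using nc by (simp add: nc')
  have h: "norm (x * lam * inverse t * inverse c) = inverse (norm c')"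
    "norm (x * inverse t * lam * inverse c) = inverse (norm c')"
    by (simp_all only: norm_mult norm_inverse nx nc' lam) (simp_all add: power2_eq_square mult_ac)
  have x': "norm c' * norm x' = 1"
    unfolding x'_def norm_minus_cancel norm_mult norm_inverse nx nc' lam
    using nc by (simp add: power2_eq_square field_simps)
  have close: "norm c' * displ lam y \<le> M" if "norm (y - p) = inverse (norm c')" for y
  proof -
    have "norm c' * displ lam y \<le> norm c' * (displ lam p + 2 * norm (qIm lam) * inverse (norm c'))"
      using displ_le[of lam y p] that by (intro mult_left_mono) auto
    also have "\<dots> = norm c' * displ lam p + 2 * norm (qIm lam)"
      using c'_pos by (simp add: distrib_left)
    also have "norm c' * displ lam p = (norm c)\<^sup>2 * (displ lam p * displ lam q)"
      by (simp add: nc' nt)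
    finally show ?thesis using X M by linarith
  qed
  have p': "norm (p' - p) = inverse (norm c')" using h by (simp add: p'_def)
  have q': "norm (q' - p) = inverse (norm c')" using h by (simp add: q'_def)
  have "norm (p' - q') \<le> norm (p' - p) + norm (q' - p)"
    using norm_triangle_ineq4[of "p' - p" "q' - p"] by simp
  then have "norm c' * norm (p' - q') \<le> 2"
    unfolding p' q' using c'_pos by (simp add: field_simps)
  moreover have "c' \<noteq> 0" using c'_pos by auto
  ultimately show ?thesis
    using that[OF conj _ x' nc'[unfolded nt] close[OF p'] close[OF q']] by blast
qed

lemma inverse_pair_mult:
  assumes "inverse_pair (A, A')" "inverse_pair (B, B')"
  shows "inverse_pair (A ** B, B' ** A')"
proof -
  have "A ** B ** (B' ** A') = A ** (B ** B') ** A'" "B' ** A' ** (A ** B) = B' ** (A' ** A) ** B"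
    by (simp_all only: matrix_mul_assoc)
  then show ?thesis using assms by (simp add: inverse_pair_def)
qed

text \<open>The matrix is the power \<open>Suc m\<close> of \<open>mat2 lam 1 0 lam\<close>. An
  inverse in G is carried through the induction, as G is assumed closed under products only.\<close>

lemma parabolic_power_mem:
  fixes lam :: quat
  assumes closed: "\<And>A B. A \<in> G \<Longrightarrow> B \<in> G \<Longrightarrow> A ** B \<in> G"
    and T: "mat2 lam 1 0 lam \<in> G" "T' \<in> G" "inverse_pair (mat2 lam 1 0 lam, T')"
  shows "mat2 (lam ^ Suc m) (of_nat (Suc m) * lam ^ m) 0 (lam ^ Suc m) \<in> G \<and>
    (\<exists>U'\<in>G. inverse_pair (mat2 (lam ^ Suc m) (of_nat (Suc m) * lam ^ m) 0 (lam ^ Suc m), U'))"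
proof (induction m)
  case 0
  then show ?case using T by auto
next
  case (Suc m)
  have "mat2 (lam ^ Suc (Suc m)) (of_nat (Suc (Suc m)) * lam ^ Suc m) 0 (lam ^ Suc (Suc m))
      = mat2 (lam ^ Suc m) (of_nat (Suc m) * lam ^ m) 0 (lam ^ Suc m) ** mat2 lam 1 0 lam"
    by (simp add: algebra_simps power_commutes)
  then show ?case using Suc T closed inverse_pair_mult by metis
qed

text \<open>Each step gives |c'| = |c| (|c| displ(q)) \<le> M |c|, hence geometric decay.\<close>

lemma descent:
  fixes lam :: quat
  assumes closed: "\<And>A B. A \<in> G \<Longrightarrow> B \<in> G \<Longrightarrow> A ** B \<in> G"
    and T: "mat2 lam 1 0 lam \<in> G" "T' \<in> G" "inverse_pair (mat2 lam 1 0 lam, T')"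
    and W: "bruhat p x c q \<in> G" "V \<in> G" "inverse_pair (bruhat p x c q, V)"
    and lam: "norm lam = 1" and c: "c \<noteq> 0" and cx: "norm c * norm x = 1"
    and M: "0 \<le> M" "M\<^sup>2 + 2 * norm (qIm lam) \<le> M"
    and X: "(norm c)\<^sup>2 * (displ lam p * displ lam q) \<le> M\<^sup>2"
  obtains K where "\<And>n. \<exists>p x c q. bruhat p x c q \<in> G \<and> (\<exists>V\<in>G. inverse_pair (bruhat p x c q, V)) \<and>
      c \<noteq> 0 \<and> norm c * norm x = 1 \<and> norm c * displ lam p \<le> M \<and> norm c * displ lam q \<le> M \<and>
      norm c * norm (p - q) \<le> 2 \<and> norm c \<le> K * M ^ n"
proof -
  have conj_G: "bruhat p x c q ** mat2 lam 1 0 lam ** bruhat q (inverse c) (inverse x) p \<in> G \<and>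
      (\<exists>V'\<in>G. inverse_pair
        (bruhat p x c q ** mat2 lam 1 0 lam ** bruhat q (inverse c) (inverse x) p, V'))"
    if "bruhat p x c q \<in> G" "V \<in> G" "inverse_pair (bruhat p x c q, V)" "c \<noteq> 0" "norm c * norm x = 1"
    for p x c q V
  proof -
    have "x \<noteq> 0" using that by auto
    then have V: "V = bruhat q (inverse c) (inverse x) p"
      using inverse_pair_unique[OF that(3)] inverse_pair_bruhat[OF that(4)] by simp
    show ?thesis
      using inverse_pair_conj[OF T(3) that(3)] T closed that unfolding V by blast
  qed
  \<comment> \<open>The hypothesis bounds only the product of the two displacements. One step bounds
    each separately, so the induction and the constant K start from c1.\<close>
  obtain p1 x1 c1 q1 where 1: "bruhat p x c q ** mat2 lam 1 0 lam ** bruhat q (inverse c) (inverse x) p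
      = bruhat p1 x1 c1 q1" "c1 \<noteq> 0" "norm c1 * norm x1 = 1"
    "norm c1 * displ lam p1 \<le> M" "norm c1 * displ lam q1 \<le> M" "norm c1 * norm (p1 - q1) \<le> 2"
    using bruhat_step[OF lam c cx M(2) X] by metis
  show ?thesis
  proof (rule that[of "norm c1"])
    fix n
    show "\<exists>p x c q. bruhat p x c q \<in> G \<and> (\<exists>V\<in>G. inverse_pair (bruhat p x c q, V)) \<and>
      c \<noteq> 0 \<and> norm c * norm x = 1 \<and> norm c * displ lam p \<le> M \<and> norm c * displ lam q \<le> M \<and>
      norm c * norm (p - q) \<le> 2 \<and> norm c \<le> norm c1 * M ^ n"
    proof (induction n)
      case 0
      have "bruhat p1 x1 c1 q1 \<in> G \<and> (\<exists>V\<in>G. inverse_pair (bruhat p1 x1 c1 q1, V))"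
        using conj_G[OF W c cx] unfolding 1 .
      then show ?case using 1 by (intro exI[of _ p1] exI[of _ x1] exI[of _ c1] exI[of _ q1]) simp
    next
      case (Suc n)
      then obtain p x c q V where W: "bruhat p x c q \<in> G" "V \<in> G" "inverse_pair (bruhat p x c q, V)"
        and c: "c \<noteq> 0" and cx: "norm c * norm x = 1"
        and fp: "norm c * displ lam p \<le> M" and fq: "norm c * displ lam q \<le> M"
        and K: "norm c \<le> norm c1 * M ^ n"
        by blast
      have "(norm c * displ lam p) * (norm c * displ lam q) \<le> M * M"
        using fp fq M(1) by (intro mult_mono) (auto simp: displ_nonneg)
      then have X: "(norm c)\<^sup>2 * (displ lam p * displ lam q) \<le> M\<^sup>2"
        by (simp add: power2_eq_square mult_ac)
      obtain p' x' c' q' where c': "bruhat p x c q ** mat2 lam 1 0 lam ** bruhat q (inverse c) (inverse x) p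
          = bruhat p' x' c' q'" "c' \<noteq> 0" "norm c' * norm x' = 1" "norm c' = (norm c)\<^sup>2 * displ lam q"
        "norm c' * displ lam p' \<le> M" "norm c' * displ lam q' \<le> M" "norm c' * norm (p' - q') \<le> 2"
        by (rule bruhat_step[OF lam c cx M(2) X])
      have "norm c' = norm c * (norm c * displ lam q)" by (simp add: c'(4) power2_eq_square)
      also have "\<dots> \<le> (norm c1 * M ^ n) * M"
        using K fq M(1) by (intro mult_mono) (auto simp: displ_nonneg)
      finally have "norm c' \<le> norm c1 * M ^ Suc n" by (simp add: mult_ac)
      moreover have "bruhat p' x' c' q' \<in> G \<and> (\<exists>V\<in>G. inverse_pair (bruhat p' x' c' q', V))"
        using conj_G[OF W c cx] unfolding c'(1) .
      ultimately show ?case using c'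
        by (intro exI[of _ p'] exI[of _ x'] exI[of _ c'] exI[of _ q']) simp
    qed
  qed
qed

text \<open>The descent controls the displacement of \<open>T\<close> at \<open>q\<close> only up to a bounded multiple of
  \<open>1 / |c|\<close>. Passing to a power \<open>T\<^sup>k\<close> with almost trivial rotation makes the
  multiple small.\<close>

lemma not_discrete_if_descent:
  fixes lam :: quat
  assumes closed: "\<And>A B. A \<in> G \<Longrightarrow> B \<in> G \<Longrightarrow> A ** B \<in> G"
    and T: "mat2 lam 1 0 lam \<in> G" "T' \<in> G" "inverse_pair (mat2 lam 1 0 lam, T')"
    and W: "bruhat p x c q \<in> G" "V \<in> G" "inverse_pair (bruhat p x c q, V)"
    and lam: "norm lam = 1" and c: "c \<noteq> 0" and cx: "norm c * norm x = 1"
    and M: "0 \<le> M" "M < 1" "M\<^sup>2 + 2 * norm (qIm lam) \<le> M"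
    and X: "(norm c)\<^sup>2 * (displ lam p * displ lam q) \<le> M\<^sup>2"
  shows "\<not> discrete G"
proof -
  \<comment> \<open>The final estimate adds up to 2 e + 3 e = 5/1024, below 1/128.\<close>
  define e where "e = (1 / 1024 :: real)"
  have e: "e > 0" by (simp add: e_def)
  obtain m \<alpha> \<gamma> where m: "lam ^ Suc m = of_real \<alpha> + \<gamma> *\<^sub>R qIm lam" "\<bar>\<gamma>\<bar> < e"
    "norm (lam ^ Suc m - 1) < e"
    by (rule unit_power_near_1[OF lam e])
  obtain K where K: "\<And>n. \<exists>p x c q. bruhat p x c q \<in> G \<and> (\<exists>V\<in>G. inverse_pair (bruhat p x c q, V)) \<and>
      c \<noteq> 0 \<and> norm c * norm x = 1 \<and> norm c * displ lam p \<le> M \<and> norm c * displ lam q \<le> M \<and>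
      norm c * norm (p - q) \<le> 2 \<and> norm c \<le> K * M ^ n"
    by (rule descent[OF closed T W lam c cx M(1) M(3) X]) iprover+
  have "(\<lambda>n. K * M ^ n) \<longlonglongrightarrow> 0"
    using M by (intro tendsto_mult_right_zero LIMSEQ_power_zero) simp
  \<comment> \<open>The divisor \<open>Suc m\<close> compensates for the off-diagonal entry of the
    power of T, whose norm is \<open>Suc m\<close>.\<close>
  then have "eventually (\<lambda>n. K * M ^ n < e / Suc m) sequentially"
    by (rule order_tendstoD) (use e in simp)
  then obtain n where n: "K * M ^ n < e / Suc m"
    using eventually_happens trivial_limit_sequentially by blast
  obtain p x c q V where W: "bruhat p x c q \<in> G" "V \<in> G" "inverse_pair (bruhat p x c q, V)"
    and c: "c \<noteq> 0" and cx: "norm c * norm x = 1" and fq: "norm c * displ lam q \<le> M"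
    and pq: "norm c * norm (p - q) \<le> 2" and cK: "norm c \<le> K * M ^ n"
    using K[of n] by blast
  have "norm c < e / Suc m" using cK n by linarith
  then have cm: "norm c * Suc m < e" by (simp add: pos_less_divide_eq)
  then have ce: "norm c < 1" using mult_left_mono[of 1 "real (Suc m)" "norm c"] by (simp add: e_def)
  define \<mu> where "\<mu> = lam ^ Suc m"
  define \<nu> where "\<nu> = of_nat (Suc m) * lam ^ m"
  have \<nu>: "norm \<nu> = Suc m" by (simp add: \<nu>_def norm_mult norm_power lam del: of_nat_Suc)
  \<comment> \<open>The summand \<alpha> of \<mu> is central, so the commutator with q is \<gamma>
    times that of \<open>lam\<close>, which \<open>displ lam q\<close> controls.\<close>
  have "\<mu> * q - q * \<mu> = \<gamma> *\<^sub>R (lam * q - q * lam)"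
    unfolding \<mu>_def m(1) by (simp add: quat_eq_iff qIm_def of_real_def algebra_simps)
  also have "lam * q - q * lam = (lam * q + 1 - q * lam) - 1" by simp
  finally have "norm (\<mu> * q - q * \<mu>) \<le> \<bar>\<gamma>\<bar> * (displ lam q + 1)"
    unfolding displ_def by (metis norm_scaleR norm_triangle_ineq4 norm_one abs_ge_zero mult_left_mono)
  moreover have "norm (\<mu> * q + \<nu> - q * \<mu>) \<le> norm (\<mu> * q - q * \<mu>) + norm \<nu>"
    using norm_triangle_ineq[of "\<mu> * q - q * \<mu>" \<nu>] by (simp add: algebra_simps)
  ultimately have "norm (\<mu> * q + \<nu> - q * \<mu>) \<le> \<bar>\<gamma>\<bar> * (displ lam q + 1) + Suc m"
    unfolding \<nu> by linarith
  then have "norm c * norm (\<mu> * q + \<nu> - q * \<mu>) \<le> norm c * (\<bar>\<gamma>\<bar> * (displ lam q + 1) + Suc m)"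
    by (intro mult_left_mono) auto
  also have "\<dots> = \<bar>\<gamma>\<bar> * (norm c * displ lam q + norm c) + norm c * Suc m"
    by (simp add: algebra_simps)
  also have "\<dots> \<le> e * (1 + 1) + e"
    using m(2) fq ce cm M by (intro add_mono mult_mono) (auto simp: displ_nonneg e_def)
  finally have small: "2 * norm (\<mu> - 1) + norm c * norm (\<mu> * q + \<nu> - q * \<mu>) \<le> 1 / 128"
    using m(3) by (simp add: \<mu>_def e_def del: power_Suc)
  obtain U' where U: "mat2 \<mu> \<nu> 0 \<mu> \<in> G" "U' \<in> G" "inverse_pair (mat2 \<mu> \<nu> 0 \<mu>, U')"
    using parabolic_power_mem[OF closed T] unfolding \<mu>_def \<nu>_def by metis
  have "lam \<noteq> 0" using lam by auto
  then have "\<mu> * z + \<nu> - z * \<mu> \<noteq> 0" for z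
    unfolding \<mu>_def \<nu>_def by (rule parabolic_power_no_fixed_point)
  with not_discrete_if_small[OF closed U(3,1,2) W(1,3,2) c cx pq small] show ?thesis by blast
qed

theorem corollary3p10:
  fixes a b c d lam :: quat and S T :: "quat^2^2" and G :: "(quat^2^2) set"
  assumes S_eq: "S = mat2 a b c d" and T_eq: "T = mat2 lam 1 0 lam"
    and S_SL: "S \<in> carrier SL2H" and T_SL: "T \<in> carrier SL2H"
    and norm_lam: "norm lam = 1" and Im_lam: "norm (qIm lam) \<le> 1 / 8"
    and G_eq: "G = generate SL2H {S, T}"
    and non_elem: "\<not> elementary G" and discr: "discrete G"
    and parab: "parabolic T" and T_infty: "mobius T Infty = Infty"
  shows "norm c * sqrt (norm (mobius_fin T (a * inverse c) - a * inverse c))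
           * sqrt (norm (mobius_fin T (- inverse c * d) - (- inverse c * d)))
         \<ge> (1 + sqrt (1 - 8 * norm (qIm lam))) / 2"
proof (rule ccontr)
  define p x q where "p = a * inverse c" and "x = b - a * inverse c * d" and "q = - (inverse c * d)"
  define X where "X = norm c * sqrt (displ lam p) * sqrt (displ lam q)"
  \<comment> \<open>The fixed points of y \<mapsto> y^2 + 2 |Im lam| are (1 - s)/2 and (1 +
    s)/2.\<close>
  define s where "s = sqrt (1 - 8 * norm (qIm lam))"
  assume "\<not> ?thesis"
  then have X_less: "X < (1 + s) / 2"
    unfolding T_eq displ_eq[OF norm_lam] by (simp add: X_def p_def q_def s_def)
  have c: "c \<noteq> 0"
  proof
    assume "c = 0"
    then have "elementary G"
      unfolding G_eq using S_SL T_SL S_eq T_eq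
      by (intro elementary_generate_upper_triangular) auto
    then show False using non_elem by blast
  qed
  have S: "S = bruhat p x c q"
    using mat2_eq_bruhat[OF c] by (simp add: S_eq p_def x_def q_def)
  have cx: "norm c * norm x = 1"
    using S_SL qdet_bruhat[OF c] by (simp add: S SL2H_def)
  have closed: "A ** B \<in> G" if "A \<in> G" "B \<in> G" for A B
    using generate.eng[of A SL2H "{S, T}" B] that by (simp add: G_eq SL2H_def)
  have inv: "\<exists>V\<in>G. inverse_pair (A, V)" if "A \<in> {S, T}" for A
  proof -
    have "A \<in> carrier SL2H" using that S_SL T_SL by auto
    then obtain V where "V \<in> carrier SL2H" "inverse_pair (A, V)" by (rule SL2H_inverse)
    then show ?thesis using generate.inv[OF that, of SL2H] inv_SL2H_eq G_eq by metis
  qed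
  obtain V T' where V: "V \<in> G" "inverse_pair (S, V)" and T': "T' \<in> G" "inverse_pair (T, T')"
    using inv by blast
  have ST: "S \<in> G" "T \<in> G" by (auto simp: G_eq intro: generate.incl)
  \<comment> \<open>The midpoint 1/2 of the two fixed points keeps M between them even when X lies
    below the smaller one.\<close>
  define M where "M = max X (1 / 2)"
  \<comment> \<open>The bound 1/8 makes the radicand nonnegative.\<close>
  have s: "0 \<le> s" "s \<le> 1" "s\<^sup>2 = 1 - 8 * norm (qIm lam)" using Im_lam by (auto simp: s_def)
  have M: "1 / 2 \<le> M" "M \<le> (1 + s) / 2" "M < 1" "X \<le> M"
    using X_less s by (auto simp: M_def)
  \<comment> \<open>Completing the square: 4 (M^2 + 2 |Im lam| - M) = (2 M - 1)^2 - s^2.\<close>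
  have "(2 * M - 1)\<^sup>2 \<le> s\<^sup>2" using M by (intro power_mono) auto
  then have M2: "M\<^sup>2 + 2 * norm (qIm lam) \<le> M" using s by (simp add: power2_eq_square algebra_simps)
  have "X \<ge> 0" by (simp add: X_def displ_nonneg)
  then have "X\<^sup>2 \<le> M\<^sup>2" using M by (intro power_mono) auto
  moreover have "X\<^sup>2 = (norm c)\<^sup>2 * (displ lam p * displ lam q)"
    by (simp add: X_def power_mult_distrib displ_nonneg)
  ultimately have "(norm c)\<^sup>2 * (displ lam p * displ lam q) \<le> M\<^sup>2" by simp
  moreover have "0 \<le> M" using M by linarith
  ultimately have "\<not> discrete G"
    using not_discrete_if_descent[OF closed ST(2)[unfolded T_eq] T'[unfolded T_eq] ST(1)[unfolded S]
        V[unfolded S] norm_lam c cx] M(3) M2 by blast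
  then show False using discr by blast
qed

end
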